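(* Let $X$ be a complex Banach space with open unit ball $B_X$. Let $f:\mathbb{D}\to B_X$ be holomorphic with $f(1)\in\partial B_X$. If $f'(1)$ exists, then $$\|f'(1)\|_X\ge \frac{2(1-\|f(0)\|_X)^2}{1-\|f(0)\|_X^2+\|f'(0)\|_X}.$$ This estimate is sharp: if $X\neq\{0\}$, there is a holomorphic function $f:\mathbb{D}\to B_X$ with $f(1)\in\partial B_X$ for which $f'(1)$ exists and $$\|f'(1)\|_X=\frac{2(1-\|f(0)\|_X)^2}{1-\|f(0)\|_X^2+\|f'(0)\|_X}.$$
   Context: $\mathbb{D}=\{z\in\mathbb{C}:|z|<1\}$. $B_X=\{x\in X:\|x\|_X<1\}$ and $\partial B_X=\{x\in X:\|x\|_X=1\}$. The hypothesis on the point $1$ means that $f$ is also assigned a value $f(1)\in\partial B_X$, and that $f'(1)$ exists as the limit in $X$ of the difference quotients, $f'(1)=\lim_{z\to1,\,z\in\mathbb{D}}\frac{f(z)-f(1)}{z-1}$. *)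

theory Defs
  imports "HOL-Analysis.Analysis"
begin

text \<open>
  Complex Banach spaces. The real structure is the one obtained by restricting scalars.
\<close>

class complex_normed_vector = real_normed_vector +
  fixes scaleC :: "complex \<Rightarrow> 'a \<Rightarrow> 'a"  (infixr \<open>*\<^sub>C\<close> 75)
  assumes scaleC_add_right: "a *\<^sub>C (x + y) = a *\<^sub>C x + a *\<^sub>C y"
    and scaleC_add_left: "(a + b) *\<^sub>C x = a *\<^sub>C x + b *\<^sub>C x"
    and scaleC_scaleC: "a *\<^sub>C (b *\<^sub>C x) = (a * b) *\<^sub>C x"
    and scaleC_of_real: "complex_of_real r *\<^sub>C x = r *\<^sub>R x"
    and norm_scaleC: "norm (a *\<^sub>C x) = cmod a * norm x"

class complex_banach = complex_normed_vector + banach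

instantiation complex :: complex_banach
begin

definition scaleC_complex :: "complex \<Rightarrow> complex \<Rightarrow> complex"
  where "scaleC_complex a x = a * x"

instance
  by standard (auto simp: scaleC_complex_def algebra_simps norm_mult scaleR_conv_of_real)

end

text \<open>
  The library's \<open>has_field_derivative\<close> and \<open>holomorphic_on\<close> only cover scalar-valued functions;
  these are their counterparts with values in a complex normed space. Since \<open>at z within S\<close>
  excludes \<open>z\<close>, the base point need not belong to \<open>S\<close>: the derivative at the boundary
  point \<open>1\<close> of the unit disc is the one with \<open>S\<close> the disc.
\<close>

definition has_complex_derivative_within ::
    "(complex \<Rightarrow> 'a::complex_normed_vector) \<Rightarrow> 'a \<Rightarrow> complex \<Rightarrow> complex set \<Rightarrow> bool"
  where "has_complex_derivative_within f D z S \<longleftrightarrow>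
    ((\<lambda>w. inverse (w - z) *\<^sub>C (f w - f z)) \<longlongrightarrow> D) (at z within S)"

definition vector_holomorphic_on ::
    "(complex \<Rightarrow> 'a::complex_normed_vector) \<Rightarrow> complex set \<Rightarrow> bool"
    (infixl \<open>vector'_holomorphic'_on\<close> 50)
  where "f vector_holomorphic_on S \<longleftrightarrow>
    (\<forall>z\<in>S. \<exists>D. has_complex_derivative_within f D z S)"

end

theory Submission
  imports Defs "HOL-Complex_Analysis.Complex_Analysis"
begin

text \<open>
  The vector-valued estimate reduces to the scalar one. By Hahn--Banach there is a complex-linear
  functional \<open>l\<close> with \<open>\<bar>l x\<bar> \<le> \<parallel>x\<parallel>\<close> for all \<open>x\<close> and \<open>l (f 1) = \<parallel>f 1\<parallel> = 1\<close>
  (\<open>complex_norming_functional\<close>). Then \<open>g = l \<circ> f\<close> is a holomorphic self-map of the disc with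
  \<open>g 1 = 1\<close>, and composing with \<open>l\<close> shrinks each of \<open>\<parallel>f 0\<parallel>\<close>, \<open>\<parallel>f' 0\<parallel>\<close> and \<open>\<parallel>f' 1\<parallel>\<close>.
  Shrinking \<open>\<parallel>f' 1\<parallel>\<close> goes in the right direction; for the other two it is harmless because
  \<open>2 (1 - a)\<^sup>2 / (1 - a\<^sup>2 + b)\<close> decreases both in \<open>a\<close> and in \<open>b\<close>
  (\<open>boundary_bound_antimono\<close>). So the estimate for \<open>g\<close> implies the one for \<open>f\<close>.

  In the scalar case put \<open>a = \<bar>g 0\<bar>\<close>. The disc automorphism taking \<open>g 0\<close> to \<open>0\<close> turns \<open>g\<close> into a
  function vanishing at \<open>0\<close>, hence of the form \<open>z h z\<close>, where \<open>\<bar>h\<bar> \<le> 1\<close> by the Schwarz lemma and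
  \<open>\<bar>h 0\<bar> = c = \<bar>g' 0\<bar> / (1 - a\<^sup>2)\<close>. The Schwarz--Pick growth estimate for \<open>h\<close> bounds
  \<open>\<bar>h z\<bar>\<close> by \<open>(c + r) / (1 + c r)\<close> with \<open>r = \<bar>z\<bar>\<close>, and undoing the automorphism bounds \<open>\<bar>g z\<bar>\<close>
  away from \<open>1\<close> (\<open>boundary_growth\<close>). Dividing \<open>1 - \<bar>g r\<bar> \<le> \<bar>1 - g r\<bar>\<close> by \<open>1 - r\<close> and letting
  \<open>r \<rightarrow> 1\<close> gives \<open>\<bar>g' 1\<bar> \<ge> 2 (1 - a) / ((1 + a) (1 + c))\<close>, which is the claimed
  bound (\<open>scalar_boundary_Schwarz\<close>).

  Equality holds for \<open>f z = z e\<close> with a unit vector \<open>e\<close>: both sides equal \<open>1\<close>.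
\<close>

section \<open>Norming functionals\<close>

text \<open>
  Only the inequality \<open>p (t x) \<le> t p x\<close> for \<open>t > 0\<close> is demanded, since this is what passes to infima
  most directly; equality for \<open>t \<ge> 0\<close> follows by applying it to \<open>1/t\<close> as well.
\<close>

definition sublinear :: "('a::real_vector \<Rightarrow> real) \<Rightarrow> bool"
  where "sublinear p \<longleftrightarrow>
    (\<forall>x y. p (x + y) \<le> p x + p y) \<and> (\<forall>t>0. \<forall>x. p (t *\<^sub>R x) \<le> t * p x)"

lemma sublinear_add: "sublinear p \<Longrightarrow> p (x + y) \<le> p x + p y"
  by (simp add: sublinear_def)

lemma sublinear_scaleR_le: "sublinear p \<Longrightarrow> t > 0 \<Longrightarrow> p (t *\<^sub>R x) \<le> t * p x"
  by (simp add: sublinear_def)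

lemma sublinear_zero:
  assumes "sublinear p"
  shows "p 0 = 0"
  using sublinear_add[OF assms, of 0 0] sublinear_scaleR_le[OF assms, of "1/2" 0] by simp

lemma sublinear_scaleR:
  assumes "sublinear p" "t \<ge> 0"
  shows "p (t *\<^sub>R x) = t * p x"
proof (cases "t = 0")
  case False
  with assms have t: "t > 0" by simp
  have "p (inverse t *\<^sub>R (t *\<^sub>R x)) \<le> inverse t * p (t *\<^sub>R x)"
    using t by (intro sublinear_scaleR_le assms) simp
  then have "t * p x \<le> p (t *\<^sub>R x)"
    using t by (simp add: field_simps)
  with sublinear_scaleR_le[OF assms(1) t, of x] show ?thesis by simp
qed (simp add: sublinear_zero[OF assms(1)])

lemma sublinear_ge:
  assumes "sublinear p"
  shows "- p (- x) \<le> p x"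
  using sublinear_add[OF assms, of x "- x"] sublinear_zero[OF assms] by simp

lemma sublinear_norm: "sublinear (norm :: 'a::real_normed_vector \<Rightarrow> real)"
  by (simp add: sublinear_def norm_triangle_ineq)

text \<open>
  The standard way of making a sublinear \<open>p\<close> smaller: the result lies below \<open>p\<close>, and the term
  \<open>t = 1\<close> bounds it by \<open>p (x + y) - p y\<close>. If \<open>p\<close> cannot be made smaller, this is exactly the missing
  half of additivity. The term \<open>t = 1\<close>, \<open>x = - y\<close> also forces every linear function below the
  result to agree with \<open>p\<close> at \<open>y\<close>. These are the two uses made of the construction.
\<close>

definition relax_along :: "('a::real_vector \<Rightarrow> real) \<Rightarrow> 'a \<Rightarrow> 'a \<Rightarrow> real"
  where "relax_along p y x = (INF t\<in>{0..}. p (x + t *\<^sub>R y) - t * p y)"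

lemma relax_along_le:
  assumes "sublinear p" "t \<ge> 0"
  shows "relax_along p y x \<le> p (x + t *\<^sub>R y) - t * p y"
  unfolding relax_along_def
proof (rule cINF_lower)
  have "- p (- x) \<le> p (x + s *\<^sub>R y) - s * p y" if "s \<ge> 0" for s
    using sublinear_add[OF assms(1), of "x + s *\<^sub>R y" "- x"]
      sublinear_scaleR[OF assms(1) that, of y] by simp
  then show "bdd_below ((\<lambda>t. p (x + t *\<^sub>R y) - t * p y) ` {0..})"
    by (intro bdd_belowI2[of _ "- p (- x)"]) auto
qed (use assms in auto)

lemma relax_along_le_self: "sublinear p \<Longrightarrow> relax_along p y x \<le> p x"
  using relax_along_le[of p 0 y x] by simp

lemma sublinear_relax_along:
  assumes p: "sublinear p"
  shows "sublinear (relax_along p y)"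
  unfolding sublinear_def
proof (intro conjI allI impI)
  have ge: "m \<le> relax_along p y x"
    if "\<And>t. t \<ge> 0 \<Longrightarrow> m \<le> p (x + t *\<^sub>R y) - t * p y" for m x
    unfolding relax_along_def using that by (intro cINF_greatest) auto
  fix x x'
  have "relax_along p y (x + x') - (p (x' + s *\<^sub>R y) - s * p y) \<le> relax_along p y x"
    if s: "s \<ge> 0" for s
  proof (rule ge)
    fix t :: real assume t: "t \<ge> 0"
    have "relax_along p y (x + x') \<le> p (x + x' + (t + s) *\<^sub>R y) - (t + s) * p y"
      using s t by (intro relax_along_le p) simp
    also have "x + x' + (t + s) *\<^sub>R y = (x + t *\<^sub>R y) + (x' + s *\<^sub>R y)"
      by (simp add: algebra_simps)
    finally show "relax_along p y (x + x') - (p (x' + s *\<^sub>R y) - s * p y) \<le> p (x + t *\<^sub>R y) - t * p y"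
      using sublinear_add[OF p, of "x + t *\<^sub>R y" "x' + s *\<^sub>R y"] by (simp add: algebra_simps)
  qed
  then have "relax_along p y (x + x') - relax_along p y x \<le> relax_along p y x'"
    by (intro ge) (smt (verit))
  then show "relax_along p y (x + x') \<le> relax_along p y x + relax_along p y x'"
    by simp
next
  fix s :: real and x assume s: "s > 0"
  have "inverse s * relax_along p y (s *\<^sub>R x) \<le> relax_along p y x"
    unfolding relax_along_def[of p y x]
  proof (rule cINF_greatest)
    fix t :: real assume "t \<in> {0..}"
    then have t: "t \<ge> 0" by simp
    have "relax_along p y (s *\<^sub>R x) \<le> p (s *\<^sub>R x + (s * t) *\<^sub>R y) - s * t * p y"
      using s t by (intro relax_along_le p) simp
    also have "s *\<^sub>R x + (s * t) *\<^sub>R y = s *\<^sub>R (x + t *\<^sub>R y)"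
      by (simp add: algebra_simps)
    also have "p \<dots> = s * p (x + t *\<^sub>R y)"
      using s by (intro sublinear_scaleR p) simp
    finally show "inverse s * relax_along p y (s *\<^sub>R x) \<le> p (x + t *\<^sub>R y) - t * p y"
      using s by (simp add: field_simps)
  qed auto
  then show "relax_along p y (s *\<^sub>R x) \<le> s * relax_along p y x"
    using s by (simp add: field_simps)
qed

lemma minimal_sublinear_linear:
  assumes p: "sublinear p" and min: "\<And>q. sublinear q \<Longrightarrow> q \<le> p \<Longrightarrow> q = p"
  shows "linear p"
proof
  have relax: "relax_along p y = p" for y
    using relax_along_le_self[OF p] by (intro min sublinear_relax_along p) (simp add: le_fun_def)
  show add: "p (x + y) = p x + p y" for x y
    using relax_along_le[OF p, of 1 y x] sublinear_add[OF p, of x y] by (simp add: relax)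
  have neg: "p (- x) = - p x" for x
    using add[of x "- x"] sublinear_zero[OF p] by simp
  show "p (t *\<^sub>R x) = t *\<^sub>R p x" for t x
  proof (cases "t \<ge> 0")
    case False
    then have "p (- ((- t) *\<^sub>R x)) = - (- t * p x)"
      unfolding neg by (subst sublinear_scaleR[OF p]) auto
    then show ?thesis by simp
  qed (simp add: sublinear_scaleR[OF p])
qed

text \<open>
  Zorn's lemma, applied to the sublinear functions below \<open>q\<close> ordered downwards, yields a minimal
  one, which is linear. A chain is bounded below by its pointwise infimum, which is finite because
  every member \<open>p\<close> satisfies \<open>p x \<ge> - p (- x) \<ge> - q (- x)\<close>.
\<close>

lemma sublinear_dominates_linear:
  assumes q: "sublinear q"
  obtains u where "linear u" "\<And>x. u x \<le> q x"
proof -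
  define A where "A = {p. sublinear p \<and> p \<le> q}"
  have "\<exists>m\<in>A. \<forall>p\<in>A. p \<le> m \<longrightarrow> p = m"
  proof (rule predicate_Zorn)
    show "partial_order_on A (relation_of (\<lambda>p p'. p' \<le> p) A)"
      by (rule partial_order_on_relation_ofI) auto
  next
    fix C assume C: "C \<in> Chains (relation_of (\<lambda>p p'. p' \<le> p) A)"
    have chain: "p \<le> p' \<or> p' \<le> p" if "p \<in> C" "p' \<in> C" for p p'
      using C that unfolding Chains_def relation_of_def by blast
    have CA: "p \<in> A" if "p \<in> C" for p
      using C that unfolding Chains_def relation_of_def by blast
    show "\<exists>u\<in>A. \<forall>p\<in>C. u \<le> p"
    proof (cases "C = {}")
      case True
      then show ?thesis using q unfolding A_def by auto
    next
      case False
      define u where "u x = (INF p\<in>C. p x)" for x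
      have lower: "u x \<le> p x" if "p \<in> C" for p x
        unfolding u_def
      proof (rule cINF_lower[OF _ that])
        have "- q (- x) \<le> p x" if "p \<in> C" for p
          using CA[OF that] sublinear_ge[of p x] unfolding A_def le_fun_def
          by (smt (verit) mem_Collect_eq)
        then show "bdd_below ((\<lambda>p. p x) ` C)"
          by (intro bdd_belowI2)
      qed
      have ge: "m \<le> u x" if "\<And>p. p \<in> C \<Longrightarrow> m \<le> p x" for m x
        unfolding u_def using that False by (intro cINF_greatest) auto
      have "sublinear u"
        unfolding sublinear_def
      proof (intro conjI allI impI)
        fix x y
        have "u (x + y) \<le> p x + p' y" if pp': "p \<in> C" "p' \<in> C" for p p'
        proof -
          \<comment> \<open>The smaller of the two members of the chain serves both summands.\<close>
          obtain r where r: "r \<in> C" "r \<le> p" "r \<le> p'"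
            using chain[OF pp'] pp' by blast
          have "u (x + y) \<le> r (x + y)" using lower r by blast
          also have "\<dots> \<le> r x + r y" using CA[OF r(1)] sublinear_add unfolding A_def by blast
          also have "\<dots> \<le> p x + p' y" using r by (intro add_mono) (auto simp: le_fun_def)
          finally show ?thesis .
        qed
        then have "u (x + y) - p' y \<le> u x" if "p' \<in> C" for p'
          using that by (intro ge) (smt (verit))
        then have "u (x + y) - u x \<le> u y"
          by (intro ge) (smt (verit))
        then show "u (x + y) \<le> u x + u y" by simp
      next
        fix t :: real and x assume t: "t > 0"
        have "inverse t * u (t *\<^sub>R x) \<le> u x"
        proof (rule ge)
          fix p assume p: "p \<in> C"
          have "u (t *\<^sub>R x) \<le> t * p x"
            using lower[OF p, of "t *\<^sub>R x"] CA[OF p] sublinear_scaleR_le[of p t x] t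
            unfolding A_def by auto
          then show "inverse t * u (t *\<^sub>R x) \<le> p x"
            using t by (simp add: field_simps)
        qed
        then show "u (t *\<^sub>R x) \<le> t * u x"
          using t by (simp add: field_simps)
      qed
      moreover have "u \<le> q"
        using False lower CA unfolding A_def le_fun_def by (smt (verit) ex_in_conv mem_Collect_eq)
      ultimately show ?thesis
        using lower unfolding A_def le_fun_def by auto
    qed
  qed
  then obtain m where m: "m \<in> A" "\<And>p. p \<in> A \<Longrightarrow> p \<le> m \<Longrightarrow> p = m" by blast
  have "linear m"
    using m unfolding A_def by (intro minimal_sublinear_linear) (auto intro: order_trans)
  then show thesis
    using m(1) that unfolding A_def le_fun_def by auto
qed

text \<open>
  A linear \<open>u\<close> below the norm need not attain it at \<open>x0\<close>. Relaxing the norm along \<open>x0\<close>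
  first forces \<open>u (- x0) \<le> - \<parallel>x0\<parallel>\<close>.
\<close>

lemma real_norming_functional:
  fixes x0 :: "'a::real_normed_vector"
  obtains u where "linear u" "\<And>x. u x \<le> norm x" "u x0 = norm x0"
proof -
  obtain u where u: "linear u" "\<And>x. u x \<le> relax_along norm x0 x"
    using sublinear_dominates_linear[OF sublinear_relax_along[OF sublinear_norm]] by blast
  have le: "u x \<le> norm x" for x
    using u(2)[of x] relax_along_le_self[OF sublinear_norm, of x0 x] by simp
  have "u (- x0) \<le> norm (- x0 + 1 *\<^sub>R x0) - 1 * norm x0"
    using u(2)[of "- x0"] relax_along_le[OF sublinear_norm, of 1 x0 "- x0"] by simp
  then have "norm x0 \<le> u x0"
    using linear_neg[OF u(1), of x0] by simp
  with le[of x0] show thesis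
    by (intro that[OF u(1) le]) simp
qed

text \<open>
  A complex-linear functional is determined by its real part \<open>u\<close> through
  \<open>l x = u x - \<i> u (\<i> x)\<close>. Rotating \<open>x\<close> so that \<open>l x\<close> becomes nonnegative real transfers the bound
  \<open>u x \<le> \<parallel>x\<parallel>\<close> to the modulus of \<open>l\<close>.
\<close>

lemma complex_norming_functional:
  fixes x0 :: "'a::complex_normed_vector"
  obtains l :: "'a \<Rightarrow> complex" where "\<And>x y. l (x + y) = l x + l y"
    "\<And>c x. l (c *\<^sub>C x) = c * l x" "\<And>x. cmod (l x) \<le> norm x" "l x0 = of_real (norm x0)"
proof -
  obtain u where u: "linear u" "\<And>x::'a. u x \<le> norm x" "u x0 = norm x0"
    using real_norming_functional[of x0] by blast
  define l where "l x = Complex (u x) (- u (\<i> *\<^sub>C x))" for x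
  have add: "l (x + y) = l x + l y" for x y
    by (simp add: l_def linear_add[OF u(1)] scaleC_add_right complex_eq_iff)
  have split: "c *\<^sub>C x = Re c *\<^sub>R x + Im c *\<^sub>R (\<i> *\<^sub>C x)" for c and x :: 'a
  proof -
    have "c *\<^sub>C x = (of_real (Re c) + of_real (Im c) * \<i>) *\<^sub>C x"
      by (metis complex_eq mult.commute)
    then show ?thesis
      by (simp only: scaleC_add_left scaleC_scaleC[symmetric] scaleC_of_real)
  qed
  have ii: "\<i> *\<^sub>C (\<i> *\<^sub>C x) = - x" for x :: 'a
    using scaleC_of_real[of "-1" x] by (simp add: scaleC_scaleC)
  have u_split: "u (c *\<^sub>C x) = Re c * u x + Im c * u (\<i> *\<^sub>C x)" for c x
    by (subst split) (simp add: linear_add[OF u(1)] linear_scale[OF u(1)])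
  have scale: "l (c *\<^sub>C x) = c * l x" for c x
    unfolding l_def scaleC_scaleC u_split[of c] u_split[of "\<i> * c"]
    by (simp add: complex_eq_iff)
  have bound: "cmod (l x) \<le> norm x" for x
  proof (cases "l x = 0")
    case False
    define c where "c = of_real (cmod (l x)) / l x"
    have c: "cmod c = 1" "c * l x = of_real (cmod (l x))"
      using False by (auto simp: c_def norm_divide)
    have "u (c *\<^sub>C x) = Re (l (c *\<^sub>C x))"
      by (simp add: l_def)
    then have "cmod (l x) = u (c *\<^sub>C x)"
      by (simp add: scale c)
    also have "\<dots> \<le> norm x"
      using u(2)[of "c *\<^sub>C x"] by (simp add: norm_scaleC c)
    finally show ?thesis .
  qed simp
  have re: "Re (l x0) = norm x0"
    by (simp add: l_def u)
  moreover have "Im (l x0) = 0"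
    using bound[of x0] cmod_power2[of "l x0"] re
    by (smt (verit) norm_ge_zero power_mono zero_le_power2 power2_eq_iff_nonneg zero_eq_power2)
  ultimately show thesis
    by (intro that[OF add scale bound]) (simp add: complex_eq_iff)
qed

section \<open>A scalar boundary Schwarz lemma\<close>

text \<open>
  A point within pseudo-hyperbolic distance \<open>h\<close> of \<open>a\<close> is no further from the origin than the
  farthest point \<open>(\<bar>a\<bar> + h) / (1 + \<bar>a\<bar> h)\<close> of that disc. After squaring, the hypothesis
  involves \<open>w\<close> and \<open>a\<close> only through their moduli and \<open>R = Re (cnj a * w)\<close>, whose coefficient has a sign
  because \<open>h \<le> 1\<close>, so that the worst case is \<open>R = \<bar>a\<bar> \<bar>w\<bar>\<close>.
\<close>

lemma cmod_le_of_moebius_le: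
  assumes h: "0 \<le> h" "h \<le> 1" and a: "cmod a \<le> 1" and w: "cmod w \<le> 1"
    and le: "cmod (w - a) \<le> h * cmod (1 - cnj a * w)"
  shows "cmod w * (1 + cmod a * h) \<le> cmod a + h"
proof -
  define R where "R = Re (cnj a * w)"
  have R: "R \<le> cmod a * cmod w"
    unfolding R_def by (metis complex_Re_le_cmod complex_mod_cnj norm_mult)
  have "(cmod (w - a))\<^sup>2 \<le> (h * cmod (1 - cnj a * w))\<^sup>2"
    using le by (intro power_mono) auto
  then have "(cmod (w - a))\<^sup>2 \<le> h\<^sup>2 * (cmod (1 - cnj a * w))\<^sup>2"
    by (simp only: power_mult_distrib)
  moreover have "(cmod (w - a))\<^sup>2 = (cmod w)\<^sup>2 + (cmod a)\<^sup>2 - 2 * R"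
    unfolding R_def cmod_power2 by (simp add: power2_eq_square algebra_simps)
  moreover have "(cmod (1 - cnj a * w))\<^sup>2 = 1 + (cmod a)\<^sup>2 * (cmod w)\<^sup>2 - 2 * R"
    unfolding R_def cmod_power2 by (simp add: power2_eq_square algebra_simps)
  ultimately have "(cmod w)\<^sup>2 + (cmod a)\<^sup>2 - 2 * R \<le> h\<^sup>2 * (1 + (cmod a)\<^sup>2 * (cmod w)\<^sup>2 - 2 * R)"
    by metis
  then have "(cmod w)\<^sup>2 + (cmod a)\<^sup>2 - h\<^sup>2 * (1 + (cmod a)\<^sup>2 * (cmod w)\<^sup>2) \<le> 2 * R * (1 - h\<^sup>2)"
    by (simp add: algebra_simps)
  also have "\<dots> \<le> 2 * (cmod a * cmod w) * (1 - h\<^sup>2)"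
    using R h by (intro mult_right_mono) (auto simp: power_le_one)
  finally have "(cmod w - cmod a)\<^sup>2 \<le> (h * (1 - cmod a * cmod w))\<^sup>2"
    by (simp add: power2_eq_square algebra_simps)
  then have "cmod w - cmod a \<le> h * (1 - cmod a * cmod w)"
    by (rule power2_le_imp_le) (use h a w in \<open>simp add: mult_le_one\<close>)
  then show ?thesis by (simp add: algebra_simps)
qed

text \<open>
  Here \<open>z * h z\<close> is the composition of \<open>g\<close> with the disc automorphism taking \<open>g 0\<close> to \<open>0\<close>. The Schwarz
  lemma only gives \<open>\<bar>h\<bar> \<le> 1\<close>; the equality case, in which \<open>g\<close> itself is an automorphism and \<open>h\<close> a
  unimodular constant, is kept apart because growth estimates for self-maps of the open disc apply to
  \<open>h\<close> in the other case only.
\<close>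

lemma Schwarz_Pick_factorization:
  assumes holg: "g holomorphic_on ball 0 1" and g: "\<And>z. cmod z < 1 \<Longrightarrow> cmod (g z) < 1"
  obtains h where "h holomorphic_on ball 0 1"
    "(\<forall>z. cmod z < 1 \<longrightarrow> cmod (h z) < 1) \<or> (\<exists>\<alpha>. cmod \<alpha> = 1 \<and> (\<forall>z. cmod z < 1 \<longrightarrow> h z = \<alpha>))"
    "\<And>z. cmod z < 1 \<Longrightarrow> g z - g 0 = z * h z * (1 - cnj (g 0) * g z)"
    "h 0 = deriv g 0 / of_real (1 - (cmod (g 0))\<^sup>2)"
proof -
  define \<phi> where "\<phi> z = Moebius_function 0 (g 0) (g z)" for z
  have g0: "cmod (g 0) < 1" using g by simp
  have nz: "1 - cnj (g 0) * g z \<noteq> 0" if "cmod z < 1" for z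
  proof -
    have "cmod (cnj (g 0) * g z) < 1"
      using norm_mult_less[of "cnj (g 0)" 1 "g z" 1] g0 g[OF that] by simp
    then show ?thesis by auto
  qed
  have "g ` ball 0 1 \<subseteq> ball 0 1" using g by auto
  from holomorphic_on_compose_gen[OF holg Moebius_function_holomorphic[OF g0, of 0] this]
  have hol: "\<phi> holomorphic_on ball 0 1"
    by (simp add: \<phi>_def[abs_def] o_def)
  have \<phi>0: "\<phi> 0 = 0" by (simp add: \<phi>_def Moebius_function_eq_zero)
  have \<phi>1: "cmod (\<phi> z) < 1" if "cmod z < 1" for z
    unfolding \<phi>_def using g0 g[OF that] by (rule Moebius_function_norm_lt_1)
  obtain h where h: "h holomorphic_on ball 0 1" "\<And>z. cmod z < 1 \<Longrightarrow> \<phi> z = z * h z" "deriv \<phi> 0 = h 0"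
    using Schwarz3[OF hol \<phi>0] by blast
  have g': "(g has_field_derivative deriv g 0) (at 0)"
    using holg by (intro holomorphic_derivI[of g "ball 0 1"]) auto
  have "(\<phi> has_field_derivative deriv g 0 / (1 - cnj (g 0) * g 0)) (at 0)"
    unfolding \<phi>_def Moebius_function_simple using nz[of 0]
    by (auto intro!: derivative_eq_intros g')
  then have h0: "h 0 = deriv g 0 / of_real (1 - (cmod (g 0))\<^sup>2)"
    unfolding of_real_diff complex_norm_square h(3)[symmetric]
    using DERIV_imp_deriv by (simp add: mult.commute)
  have eq: "g z - g 0 = z * h z * (1 - cnj (g 0) * g z)" if "cmod z < 1" for z
    using nz[OF that] h(2)[OF that] unfolding \<phi>_def Moebius_function_simple by (simp add: field_simps)
  have alt: "(\<forall>z. cmod z < 1 \<longrightarrow> cmod (h z) < 1) \<or> (\<exists>\<alpha>. cmod \<alpha> = 1 \<and> (\<forall>z. cmod z < 1 \<longrightarrow> h z = \<alpha>))"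
  proof (cases "(\<exists>z. cmod z < 1 \<and> z \<noteq> 0 \<and> cmod (\<phi> z) = cmod z) \<or> cmod (deriv \<phi> 0) = 1")
    case True
    then obtain \<alpha> where \<alpha>: "\<forall>z. cmod z < 1 \<longrightarrow> \<phi> z = \<alpha> * z" "cmod \<alpha> = 1"
      using Schwarz_Lemma(3)[OF hol \<phi>0 \<phi>1 _ True, where \<xi> = 0] by fastforce
    have "deriv \<phi> 0 = \<alpha>"
    proof (rule DERIV_imp_deriv)
      have "((\<lambda>z. \<alpha> * z) has_field_derivative \<alpha>) (at 0)"
        by (auto intro!: derivative_eq_intros)
      then show "(\<phi> has_field_derivative \<alpha>) (at 0)"
        by (rule has_field_derivative_transform_within_open[of _ _ _ "ball 0 1"]) (use \<alpha> in auto)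
    qed
    then have "h 0 = \<alpha>" using h(3) by simp
    moreover have "h z = \<alpha>" if "cmod z < 1" "z \<noteq> 0" for z
      using h(2)[OF that(1)] \<alpha>(1) that by simp
    ultimately show ?thesis using \<alpha>(2) by metis
  next
    case False
    have "cmod (h z) < 1" if "cmod z < 1" for z
    proof (cases "z = 0")
      case True
      then show ?thesis using Schwarz_Lemma(2)[OF hol \<phi>0 \<phi>1, of 0] False h(3) by auto
    next
      case z: False
      have "cmod (\<phi> z) < cmod z"
        using Schwarz_Lemma(1)[OF hol \<phi>0 \<phi>1 that] False that z by (meson order_le_less)
      then show ?thesis
        using z by (simp add: h(2)[OF that] norm_mult)
    qed
    then show ?thesis by blast
  qed
  show thesis by (rule that[OF h(1) alt eq h0])
qed

lemma Schwarz_Pick_growth: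
  assumes holg: "g holomorphic_on ball 0 1" and g: "\<And>z. cmod z < 1 \<Longrightarrow> cmod (g z) < 1"
    and z: "cmod z < 1"
  shows "cmod (g z) * (1 + cmod (g 0) * cmod z) \<le> cmod (g 0) + cmod z"
proof -
  obtain h where "(\<forall>z. cmod z < 1 \<longrightarrow> cmod (h z) < 1) \<or> (\<exists>\<alpha>. cmod \<alpha> = 1 \<and> (\<forall>z. cmod z < 1 \<longrightarrow> h z = \<alpha>))"
    and eq: "g z - g 0 = z * h z * (1 - cnj (g 0) * g z)"
    using Schwarz_Pick_factorization[OF holg g] z by metis
  then have "cmod (h z) \<le> 1" using z by (metis less_eq_real_def)
  then have "cmod (g z - g 0) \<le> cmod z * cmod (1 - cnj (g 0) * g z)"
    unfolding eq norm_mult by (intro mult_right_mono mult_left_le) auto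
  then show ?thesis
    using g[of 0] g[OF z] z by (intro cmod_le_of_moebius_le) auto
qed

text \<open>
  The growth estimate for \<open>g\<close> refined by the size of \<open>deriv g 0\<close>: it results from applying the growth
  estimate to the factor \<open>h\<close> of \<open>Schwarz_Pick_factorization\<close>, which starts with modulus \<open>c\<close> at the
  origin. The factor \<open>1 - r\<^sup>2\<close> on the left makes the quotient by \<open>1 - r\<close> converge to a positive number
  at the boundary.
\<close>

lemma boundary_growth:
  assumes holg: "g holomorphic_on ball 0 1" and g: "\<And>z. cmod z < 1 \<Longrightarrow> cmod (g z) < 1"
    and z: "cmod z < 1"
  defines "a \<equiv> cmod (g 0)" and "r \<equiv> cmod z"
  defines "c \<equiv> cmod (deriv g 0) / (1 - a\<^sup>2)"
  shows "(1 - a) * (1 - r\<^sup>2) / (1 + c * r + a * r * (c + r)) \<le> 1 - cmod (g z)"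
proof -
  obtain h where h: "h holomorphic_on ball 0 1"
    and alt: "(\<forall>z. cmod z < 1 \<longrightarrow> cmod (h z) < 1) \<or> (\<exists>\<alpha>. cmod \<alpha> = 1 \<and> (\<forall>z. cmod z < 1 \<longrightarrow> h z = \<alpha>))"
    and eq: "\<And>z. cmod z < 1 \<Longrightarrow> g z - g 0 = z * h z * (1 - cnj (g 0) * g z)"
    and h0: "h 0 = deriv g 0 / of_real (1 - (cmod (g 0))\<^sup>2)"
    using Schwarz_Pick_factorization[OF holg g] by metis
  have a: "0 \<le> a" "a < 1" and r: "0 \<le> r" "r < 1"
    using g[of 0] z by (auto simp: a_def r_def)
  have a2: "a\<^sup>2 < 1" using a by (simp add: power_less_one_iff)
  have c: "cmod (h 0) = c"
  proof -
    have "cmod (of_real (1 - (cmod (g 0))\<^sup>2)) = 1 - a\<^sup>2"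
      using a2 unfolding norm_of_real a_def by simp
    then show ?thesis unfolding h0 c_def norm_divide by simp
  qed
  have c0: "0 \<le> c" using c norm_ge_zero by metis
  define s where "s = cmod (h z)"
  have s: "0 \<le> s" "s \<le> 1" and s_le: "s * (1 + c * r) \<le> c + r"
  proof -
    show "0 \<le> s" by (simp add: s_def)
    show "s \<le> 1" using alt z by (auto simp: s_def less_imp_le)
    show "s * (1 + c * r) \<le> c + r"
      using alt
    proof
      assume "\<forall>z. cmod z < 1 \<longrightarrow> cmod (h z) < 1"
      then show ?thesis
        using Schwarz_Pick_growth[OF h _ z] unfolding c s_def r_def by blast
    next
      assume "\<exists>\<alpha>. cmod \<alpha> = 1 \<and> (\<forall>z. cmod z < 1 \<longrightarrow> h z = \<alpha>)"
      then have "s = 1" "c = 1" using z c unfolding s_def by auto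
      then show ?thesis by simp
    qed
  qed
  have g_le: "cmod (g z) * (1 + a * (r * s)) \<le> a + r * s"
    unfolding a_def
  proof (rule cmod_le_of_moebius_le)
    show "cmod (g z - g 0) \<le> r * s * cmod (1 - cnj (g 0) * g z)"
      by (simp add: eq[OF z] norm_mult r_def s_def)
    show "r * s \<le> 1" using r s by (simp add: mult_le_one)
  qed (use r s g[of 0] g[OF z] in auto)
  define d where "d = 1 + c * r"
  have d: "d > 0" using c0 r by (simp add: d_def add_pos_nonneg)
  have D: "d + a * r * (c + r) > 0" using d a r c0 by (simp add: add_pos_nonneg)
  have E: "1 + a * (r * s) > 0" using a r s by (simp add: add_pos_nonneg)
  have "(1 - a) * (1 - r\<^sup>2) / (d + a * r * (c + r)) \<le> (1 - a) * (1 - r * s) / (1 + a * (r * s))"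
  proof -
    have rs: "r * s * d \<le> r * (c + r)"
      using mult_left_mono[OF s_le r(1)] by (simp add: d_def mult.assoc)
    have "(1 - r\<^sup>2) * (1 + a * (r * s)) \<le> (1 - r * s) * (d + a * r * (c + r))"
    proof -
      \<comment> \<open>With \<open>x = r * s\<close>, the quotient \<open>(1 - x) / (1 + a * x)\<close> decreases in \<open>x\<close>, and its value at the
          largest admissible \<open>x = r * (c + r) / d\<close> is \<open>(1 - r\<^sup>2) / (d + a * r * (c + r))\<close>.\<close>
      have "(1 - r * s) * (d + a * r * (c + r)) - (1 - r\<^sup>2) * (1 + a * (r * s))
         = (1 + a) * (r * (c + r) - r * s * d)"
        by (simp add: d_def power2_eq_square algebra_simps)
      also have "\<dots> \<ge> 0" using rs a by simp
      finally show ?thesis by simp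
    qed
    then have "(1 - r\<^sup>2) / (d + a * r * (c + r)) \<le> (1 - r * s) / (1 + a * (r * s))"
      using D E by (simp add: divide_simps)
    then have "(1 - a) * ((1 - r\<^sup>2) / (d + a * r * (c + r))) \<le> (1 - a) * ((1 - r * s) / (1 + a * (r * s)))"
      using a by (intro mult_left_mono) auto
    then show ?thesis by simp
  qed
  also have "(1 - a) * (1 - r * s) / (1 + a * (r * s)) \<le> 1 - cmod (g z)"
    using E g_le by (simp add: divide_simps algebra_simps)
  finally show ?thesis by (simp add: d_def)
qed

text \<open>
  The existence of the derivative at \<open>1\<close> allows it to be computed along the radius, where
  \<open>\<bar>g r - b\<bar> \<ge> 1 - \<bar>g r\<bar>\<close> and \<open>boundary_growth\<close> applies.
\<close>

lemma scalar_boundary_Schwarz: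
  assumes holg: "g holomorphic_on ball 0 1" and g: "\<And>z. cmod z < 1 \<Longrightarrow> cmod (g z) < 1"
    and b: "cmod b = 1" and lim: "((\<lambda>w. (g w - b) / (w - 1)) \<longlongrightarrow> L) (at 1 within ball 0 1)"
  shows "2 * (1 - cmod (g 0))\<^sup>2 / (1 - (cmod (g 0))\<^sup>2 + cmod (deriv g 0)) \<le> cmod L"
proof -
  define a where "a = cmod (g 0)"
  define c where "c = cmod (deriv g 0) / (1 - a\<^sup>2)"
  have a: "0 \<le> a" "a < 1" using g[of 0] by (auto simp: a_def)
  have a2: "a\<^sup>2 < 1" using a by (simp add: power_less_one_iff)
  have c: "c \<ge> 0" using a2 by (simp add: c_def)
  let ?q = "\<lambda>r. (1 - a) * (1 + r) / (1 + c * r + a * r * (c + r))"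
  have near: "\<forall>\<^sub>F r in at_left (1::real). 0 < r \<and> r < 1"
    using eventually_at_left_real[of 0 1] by (auto elim: eventually_mono)
  have "filterlim complex_of_real (at 1 within ball 0 1) (at_left 1)"
    unfolding filterlim_at
  proof
    show "\<forall>\<^sub>F r in at_left (1::real). complex_of_real r \<in> ball 0 1 \<and> complex_of_real r \<noteq> 1"
      using near by eventually_elim auto
    show "(complex_of_real \<longlongrightarrow> 1) (at_left 1)"
      using tendsto_of_real[OF tendsto_ident_at, of 1 "{..<1::real}"] by simp
  qed
  from tendsto_norm[OF filterlim_compose[OF lim this]]
  have L: "((\<lambda>r. cmod ((g (of_real r) - b) / (of_real r - 1))) \<longlongrightarrow> cmod L) (at_left 1)" .
  have Q: "(?q \<longlongrightarrow> ?q 1) (at_left 1)"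
    using a c by (intro tendsto_intros) (smt (verit) mult_nonneg_nonneg)
  have le: "\<forall>\<^sub>F r in at_left 1. ?q r \<le> cmod ((g (of_real r) - b) / (of_real r - 1))"
    using near
  proof eventually_elim
    case (elim r)
    have "(1 - a) * (1 - r\<^sup>2) / (1 + c * r + a * r * (c + r)) \<le> 1 - cmod (g (of_real r))"
      using boundary_growth[OF holg g, of "of_real r"] elim unfolding a_def c_def by simp
    also have "\<dots> \<le> cmod (g (of_real r) - b)"
      using norm_triangle_ineq2[of b "g (of_real r)"] b by (simp add: norm_minus_commute)
    finally have *: "(1 - a) * (1 - r\<^sup>2) / (1 + c * r + a * r * (c + r)) \<le> cmod (g (of_real r) - b)" .
    have "?q r = (1 - a) * (1 - r\<^sup>2) / (1 + c * r + a * r * (c + r)) / (1 - r)"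
      using elim by (simp add: power2_eq_square divide_simps) (simp add: algebra_simps)
    also have "\<dots> \<le> cmod (g (of_real r) - b) / (1 - r)"
      using * elim by (intro divide_right_mono) auto
    also have "1 - r = cmod (of_real r - 1)"
      using elim by (metis abs_minus_commute abs_of_pos diff_gt_0_iff_gt norm_of_real of_real_1 of_real_diff)
    finally show ?case by (simp add: norm_divide)
  qed
  have "?q 1 \<le> cmod L"
    by (rule tendsto_le[OF _ L Q le]) simp
  moreover have "?q 1 = 2 * (1 - a)\<^sup>2 / (1 - a\<^sup>2 + cmod (deriv g 0))"
  proof -
    have cd: "cmod (deriv g 0) = c * (1 - a\<^sup>2)" using a2 by (simp add: c_def)
    have "1 - a\<^sup>2 + c * (1 - a\<^sup>2) = (1 - a) * ((1 + a) * (1 + c))"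
      by (simp add: power2_eq_square algebra_simps)
    moreover have "1 + c * 1 + a * 1 * (c + 1) = (1 + a) * (1 + c)"
      by (simp add: algebra_simps)
    moreover have "(1 + a) * (1 + c) > 0" using a c by simp
    ultimately show ?thesis
      unfolding cd using a by (simp add: power2_eq_square)
  qed
  ultimately show ?thesis by (simp add: a_def)
qed

text \<open>
  This monotonicity is what makes it harmless to replace \<open>f\<close> by \<open>l \<circ> f\<close>, although the
  replacement changes the values at the origin as well.
\<close>

lemma boundary_bound_antimono:
  fixes a A b B :: real
  assumes "0 \<le> a" "a \<le> A" "A < 1" "0 \<le> b" "b \<le> B"
  shows "2 * (1 - A)\<^sup>2 / (1 - A\<^sup>2 + B) \<le> 2 * (1 - a)\<^sup>2 / (1 - a\<^sup>2 + b)"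
proof -
  have A2: "A\<^sup>2 < 1" and a2: "a\<^sup>2 < 1" using assms by (auto simp: power_less_one_iff)
  have "2 * (1 - A)\<^sup>2 / (1 - A\<^sup>2 + B) \<le> 2 * (1 - A)\<^sup>2 / (1 - A\<^sup>2 + b)"
    using assms A2 by (intro divide_left_mono) auto
  also have "\<dots> \<le> 2 * (1 - a)\<^sup>2 / (1 - a\<^sup>2 + b)"
  proof -
    have "(1 - A)\<^sup>2 * (1 - a\<^sup>2) \<le> (1 - a)\<^sup>2 * (1 - A\<^sup>2)"
    proof -
      have "(1 - a)\<^sup>2 * (1 - A\<^sup>2) - (1 - A)\<^sup>2 * (1 - a\<^sup>2) = 2 * ((1 - a) * (1 - A) * (A - a))"
        by (simp add: power2_eq_square algebra_simps)
      also have "\<dots> \<ge> 0" using assms by simp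
      finally show ?thesis by simp
    qed
    moreover have "(1 - A)\<^sup>2 * b \<le> (1 - a)\<^sup>2 * b"
      using assms by (intro mult_right_mono power_mono) auto
    ultimately have "(1 - A)\<^sup>2 * (1 - a\<^sup>2 + b) \<le> (1 - a)\<^sup>2 * (1 - A\<^sup>2 + b)"
      by (simp add: distrib_left)
    moreover have "1 - a\<^sup>2 + b > 0" "1 - A\<^sup>2 + b > 0" using A2 a2 assms by linarith+
    ultimately show ?thesis by (simp add: divide_simps)
  qed
  finally show ?thesis .
qed

section \<open>The Banach space valued boundary Schwarz lemma\<close>

lemma has_complex_derivative_within_functional:
  fixes l :: "'a::complex_normed_vector \<Rightarrow> complex"
  assumes add: "\<And>x y. l (x + y) = l x + l y" and scale: "\<And>c x. l (c *\<^sub>C x) = c * l x"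
    and bound: "\<And>x. cmod (l x) \<le> norm x"
    and f: "has_complex_derivative_within f D z S"
  shows "((\<lambda>w. (l (f w) - l (f z)) / (w - z)) \<longlongrightarrow> l D) (at z within S)"
proof -
  have bl: "bounded_linear l"
  proof (rule bounded_linear_intro[where K = 1])
    show "l (r *\<^sub>R x) = r *\<^sub>R l x" for r x
      using scale[of "of_real r" x] by (simp add: scaleC_of_real scaleR_conv_of_real)
  qed (use add bound in auto)
  have "l (inverse (w - z) *\<^sub>C (f w - f z)) = (l (f w) - l (f z)) / (w - z)" for w
    by (simp add: scale linear_diff[OF bounded_linear.linear[OF bl]] divide_inverse mult.commute)
  then show ?thesis
    using bounded_linear.tendsto[OF bl f[unfolded has_complex_derivative_within_def]] by simp
qed

lemma boundary_Schwarz: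
  fixes f :: "complex \<Rightarrow> 'a::complex_normed_vector"
  assumes hol: "f vector_holomorphic_on ball 0 1" and sub: "f ` ball 0 1 \<subseteq> ball 0 1"
    and f1: "norm (f 1) = 1"
    and df0: "has_complex_derivative_within f df0 0 (ball 0 1)"
    and df1: "has_complex_derivative_within f df1 1 (ball 0 1)"
  shows "2 * (1 - norm (f 0))\<^sup>2 / (1 - (norm (f 0))\<^sup>2 + norm df0) \<le> norm df1"
proof -
  obtain l :: "'a \<Rightarrow> complex" where add: "\<And>x y. l (x + y) = l x + l y"
    and scale: "\<And>c x. l (c *\<^sub>C x) = c * l x"
    and bound: "\<And>x. cmod (l x) \<le> norm x" and l1: "l (f 1) = of_real (norm (f 1))"
    using complex_norming_functional[of "f 1"] by blast
  note functional = has_complex_derivative_within_functional[OF add scale bound]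
  define g where "g z = l (f z)" for z
  have fz: "norm (f z) < 1" if "cmod z < 1" for z
    using sub that by (auto simp: image_subset_iff)
  have g: "cmod (g z) < 1" if "cmod z < 1" for z
    using le_less_trans[OF bound fz[OF that]] by (simp add: g_def)
  have holg: "g holomorphic_on ball 0 1"
    using hol functional
    unfolding vector_holomorphic_on_def holomorphic_on_def field_differentiable_def
      has_field_derivative_iff g_def by blast
  have "(g has_field_derivative l df0) (at 0 within ball 0 1)"
    using functional[OF df0] by (simp add: has_field_derivative_iff g_def)
  then have d: "deriv g 0 = l df0"
    by (intro DERIV_imp_deriv) (simp add: at_within_open[of 0 "ball 0 1"])
  have "2 * (1 - norm (f 0))\<^sup>2 / (1 - (norm (f 0))\<^sup>2 + norm df0)
     \<le> 2 * (1 - cmod (g 0))\<^sup>2 / (1 - (cmod (g 0))\<^sup>2 + cmod (deriv g 0))"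
    using bound fz[of 0] by (intro boundary_bound_antimono) (auto simp: d g_def)
  also have "\<dots> \<le> cmod (l df1)"
    using functional[OF df1] by (intro scalar_boundary_Schwarz[OF holg g, of "g 1"])
      (auto simp: g_def l1 f1)
  also have "\<dots> \<le> norm df1" by (rule bound)
  finally show ?thesis .
qed

text \<open>
  The difference quotient of \<open>z \<mapsto> z e\<close> is constant, so this one computation covers the disc, the
  origin and the boundary point of the extremal function.
\<close>

lemma has_complex_derivative_within_line:
  "has_complex_derivative_within (\<lambda>z. z *\<^sub>C e) e z S"
proof -
  have "inverse (w - z) *\<^sub>C (w *\<^sub>C e - z *\<^sub>C e) = e" if "w \<noteq> z" for w
  proof -
    have "w *\<^sub>C e - z *\<^sub>C e = (w - z) *\<^sub>C e"
      using scaleC_add_left[of "w - z" z e] by simp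
    then show ?thesis
      using that scaleC_of_real[of 1 e] by (simp add: scaleC_scaleC)
  qed
  then show ?thesis
    unfolding has_complex_derivative_within_def
    by (intro tendsto_eventually) (auto simp: eventually_at_filter)
qed

theorem theorem2p5:
  shows "(\<forall>(f :: complex \<Rightarrow> 'a::complex_banach) df0 df1.
            f vector_holomorphic_on ball 0 1 \<longrightarrow>
            f ` ball 0 1 \<subseteq> ball 0 1 \<longrightarrow>
            f 1 \<in> sphere 0 1 \<longrightarrow>
            has_complex_derivative_within f df0 0 (ball 0 1) \<longrightarrow>
            has_complex_derivative_within f df1 1 (ball 0 1) \<longrightarrow>
            norm df1 \<ge> 2 * (1 - norm (f 0))\<^sup>2 / (1 - (norm (f 0))\<^sup>2 + norm df0))
       \<and> ((\<exists>x :: 'a. x \<noteq> 0) \<longrightarrow>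
          (\<exists>(f :: complex \<Rightarrow> 'a) df0 df1.
            f vector_holomorphic_on ball 0 1 \<and>
            f ` ball 0 1 \<subseteq> ball 0 1 \<and>
            f 1 \<in> sphere 0 1 \<and>
            has_complex_derivative_within f df0 0 (ball 0 1) \<and>
            has_complex_derivative_within f df1 1 (ball 0 1) \<and>
            norm df1 = 2 * (1 - norm (f 0))\<^sup>2 / (1 - (norm (f 0))\<^sup>2 + norm df0)))"
proof (intro conjI allI impI)
  fix f :: "complex \<Rightarrow> 'a" and df0 df1
  assume "f vector_holomorphic_on ball 0 1" "f ` ball 0 1 \<subseteq> ball 0 1" "f 1 \<in> sphere 0 1"
    "has_complex_derivative_within f df0 0 (ball 0 1)"
    "has_complex_derivative_within f df1 1 (ball 0 1)"
  then show "norm df1 \<ge> 2 * (1 - norm (f 0))\<^sup>2 / (1 - (norm (f 0))\<^sup>2 + norm df0)"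
    by (intro boundary_Schwarz) auto
next
  assume "\<exists>x :: 'a. x \<noteq> 0"
  then obtain x :: 'a where x: "x \<noteq> 0" ..
  define e where "e = sgn x"
  have e: "norm e = 1" using x by (simp add: e_def norm_sgn)
  have "(\<lambda>z. z *\<^sub>C e) vector_holomorphic_on ball 0 1"
    unfolding vector_holomorphic_on_def using has_complex_derivative_within_line by blast
  then show "\<exists>(f :: complex \<Rightarrow> 'a) df0 df1.
            f vector_holomorphic_on ball 0 1 \<and>
            f ` ball 0 1 \<subseteq> ball 0 1 \<and>
            f 1 \<in> sphere 0 1 \<and>
            has_complex_derivative_within f df0 0 (ball 0 1) \<and>
            has_complex_derivative_within f df1 1 (ball 0 1) \<and>
            norm df1 = 2 * (1 - norm (f 0))\<^sup>2 / (1 - (norm (f 0))\<^sup>2 + norm df0)"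
    by (intro exI[of _ "\<lambda>z. z *\<^sub>C e"] exI[of _ e])
      (auto simp: has_complex_derivative_within_line norm_scaleC e)
qed

end
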